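(* Let $G$ be a finite group, $N\unlhd G$ a normal subgroup and $K$ a field. Assume that $\operatorname{Irr}(G)=\{\chi_1,\ldots,\chi_r\}$ and $\operatorname{Irr}(G/N)=\{\widetilde{\chi_1},\ldots,\widetilde{\chi_s}\}$, where $s\leq r$ and $\chi_i$ is the inflation to $G$ of $\widetilde{\chi_i}$ for $1\le i\le s$ (so that $N\subset\operatorname{Ker}(\chi_i)$ if and only if $1\leq i\leq s$). Then, as subalgebras of $K[x_1,\ldots,x_r]$, $$R_{G/N}=R_G\cap K[x_1,\ldots,x_s].$$
   Context: Characters are complex characters of finite groups. For a finite group $G$ with $\operatorname{Irr}(G)=\{\chi_1,\ldots,\chi_r\}$, $\operatorname{Ch}(G)=\{a_1\chi_1+\cdots+a_r\chi_r : a_i\in\mathbb{N}\}$ (including $0$). A character of $G$ is monomial if it equals $\lambda^G$ (induced character) for some subgroup $H\leqslant G$ and some linear (degree one) character $\lambda$ of $H$. $M(G)$ is the submonoid of $(\operatorname{Ch}(G),+)$ generated by the monomial characters. $R_G=K[M(G)]\subset K[x_1,\ldots,x_r]$ is the $K$-subalgebra spanned by the monomials $x_1^{a_1}\cdots x_r^{a_r}$ with $a_1\chi_1+\cdots+a_r\chi_r\in M(G)$. The inflation of $\widetilde\chi\in\operatorname{Irr}(G/N)$ is the character $\chi$ of $G$ with $\chi(g)=\widetilde\chi(gN)$; inflation is a bijection from $\operatorname{Irr}(G/N)$ onto $\{\chi\in\operatorname{Irr}(G): N\subset\operatorname{Ker}(\chi)\}$. The algebra $R_{G/N}$ is formed in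 $K[x_1,\ldots,x_s]\subset K[x_1,\ldots,x_r]$, with the variable $x_i$ corresponding to $\widetilde{\chi_i}$. *)

theory Defs
  imports
    "HOL-Algebra.Coset"
    "HOL-Library.Poly_Mapping"
    "Jordan_Normal_Form.VS_Connect"
begin

section \<open>Complex characters of finite groups\<close>

text \<open>
  The degree \<open>n = 0\<close> is allowed; it yields the zero character.
\<close>

definition is_rep :: "('g, 'm) monoid_scheme \<Rightarrow> nat \<Rightarrow> ('g \<Rightarrow> complex mat) \<Rightarrow> bool" where
  "is_rep G n \<rho> \<longleftrightarrow> \<rho> \<in> hom G (units_of (ring_mat TYPE(complex) n ()))"

definition irreducible_rep :: "('g, 'm) monoid_scheme \<Rightarrow> nat \<Rightarrow> ('g \<Rightarrow> complex mat) \<Rightarrow> bool" where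
  "irreducible_rep G n \<rho> \<longleftrightarrow> is_rep G n \<rho> \<and> 0 < n \<and>
    (\<forall>W. VectorSpace.subspace class_ring W (module_vec TYPE(complex) n) \<longrightarrow>
         (\<forall>g\<in>carrier G. \<forall>w\<in>W. \<rho> g *\<^sub>v w \<in> W) \<longrightarrow>
         W = {0\<^sub>v n} \<or> W = carrier_vec n)"

text \<open>
  Class functions on \<open>G\<close> are functions on the whole type that vanish outside
  \<open>carrier G\<close>, so that equality and pointwise addition of functions on the type are
  equality and addition of functions on the group.
\<close>

definition rep_char :: "('g, 'm) monoid_scheme \<Rightarrow> ('g \<Rightarrow> complex mat) \<Rightarrow> 'g \<Rightarrow> complex" where
  "rep_char G \<rho> = (\<lambda>g. if g \<in> carrier G then (\<Sum>i<dim_row (\<rho> g). \<rho> g $$ (i, i)) else 0)"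

definition is_character :: "('g, 'm) monoid_scheme \<Rightarrow> ('g \<Rightarrow> complex) \<Rightarrow> bool" where
  "is_character G \<chi> \<longleftrightarrow> (\<exists>n \<rho>. is_rep G n \<rho> \<and> \<chi> = rep_char G \<rho>)"

definition Irr :: "('g, 'm) monoid_scheme \<Rightarrow> ('g \<Rightarrow> complex) set" where
  "Irr G = {\<chi>. \<exists>n \<rho>. irreducible_rep G n \<rho> \<and> \<chi> = rep_char G \<rho>}"

definition linear_character :: "('g, 'm) monoid_scheme \<Rightarrow> ('g \<Rightarrow> complex) \<Rightarrow> bool" where
  "linear_character G \<mu> \<longleftrightarrow> is_character G \<mu> \<and> \<mu> \<one>\<^bsub>G\<^esub> = 1"

definition induced :: "('g, 'm) monoid_scheme \<Rightarrow> 'g set \<Rightarrow> ('g \<Rightarrow> complex) \<Rightarrow> 'g \<Rightarrow> complex" where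
  "induced G H \<phi> = (\<lambda>g. if g \<in> carrier G then
      (\<Sum>x\<in>carrier G.
         let y = inv\<^bsub>G\<^esub> x \<otimes>\<^bsub>G\<^esub> g \<otimes>\<^bsub>G\<^esub> x in if y \<in> H then \<phi> y else 0) / of_nat (card H)
    else 0)"

definition inflation :: "('g, 'm) monoid_scheme \<Rightarrow> 'g set \<Rightarrow> ('g set \<Rightarrow> complex) \<Rightarrow> 'g \<Rightarrow> complex"
  where "inflation G N \<phi> = (\<lambda>g. if g \<in> carrier G then \<phi> (N #>\<^bsub>G\<^esub> g) else 0)"


section \<open>The monoid of sums of monomial characters and its algebra\<close>

text \<open>
  The function \<^term>\<open>induced G H \<phi>\<close> is a character of \<open>G\<close> whenever \<open>\<phi>\<close> is a
  character of the subgroup \<open>H\<close> of the finite group \<open>G\<close>; this is not repeated as a condition.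
\<close>

definition monomial_character :: "('g, 'm) monoid_scheme \<Rightarrow> ('g \<Rightarrow> complex) \<Rightarrow> bool" where
  "monomial_character G \<chi> \<longleftrightarrow>
    (\<exists>H \<mu>. subgroup H G \<and> linear_character (G\<lparr>carrier := H\<rparr>) \<mu> \<and> \<chi> = induced G H \<mu>)"

inductive_set monomial_monoid :: "('g, 'm) monoid_scheme \<Rightarrow> ('g \<Rightarrow> complex) set"
  for G :: "('g, 'm) monoid_scheme" where
  zero: "(\<lambda>_. 0) \<in> monomial_monoid G"
| monomial: "monomial_character G \<chi> \<Longrightarrow> \<chi> \<in> monomial_monoid G"
| add: "\<phi> \<in> monomial_monoid G \<Longrightarrow> \<psi> \<in> monomial_monoid G \<Longrightarrow>
    (\<lambda>g. \<phi> g + \<psi> g) \<in> monomial_monoid G"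

text \<open>
  Polynomials over \<open>'k\<close> in the variables \<open>x\<^sub>i\<close>, \<open>i\<close> a natural number, are elements of
  \<^typ>\<open>(nat \<Rightarrow>\<^sub>0 nat) \<Rightarrow>\<^sub>0 'k\<close>; the monomial with exponent vector \<open>a\<close> is \<open>single a 1\<close> and
  the constant \<open>c\<close> is \<open>single 0 c\<close>.
\<close>

definition poly_scale ::
  "'k::field \<Rightarrow> ((nat \<Rightarrow>\<^sub>0 nat) \<Rightarrow>\<^sub>0 'k) \<Rightarrow> ((nat \<Rightarrow>\<^sub>0 nat) \<Rightarrow>\<^sub>0 'k)" where
  "poly_scale c p = Poly_Mapping.single 0 c * p"

lemma vector_space_poly_scale: "vector_space poly_scale"
  by unfold_locales
    (simp_all add: poly_scale_def algebra_simps single_add mult_single flip: mult.assoc)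

definition polys_in :: "nat set \<Rightarrow> ((nat \<Rightarrow>\<^sub>0 nat) \<Rightarrow>\<^sub>0 'k::field) set" where
  "polys_in V = {p. \<forall>a\<in>Poly_Mapping.keys p. Poly_Mapping.keys a \<subseteq> V}"

text \<open>
  In the following \<open>\<chi>\<close> enumerates \<^term>\<open>Irr G\<close> over the indices \<open>1, \<dots>, r\<close>, and \<open>x\<^sub>i\<close> is
  the variable of \<open>\<chi> i\<close>.
\<close>

definition monomial_exponents ::
  "('g, 'm) monoid_scheme \<Rightarrow> nat \<Rightarrow> (nat \<Rightarrow> 'g \<Rightarrow> complex) \<Rightarrow> (nat \<Rightarrow>\<^sub>0 nat) set" where
  "monomial_exponents G r \<chi> = {a. Poly_Mapping.keys a \<subseteq> {1..r} \<and>
    (\<lambda>g. \<Sum>i=1..r. of_nat (Poly_Mapping.lookup a i) * \<chi> i g) \<in> monomial_monoid G}"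

definition monomial_algebra ::
  "('g, 'm) monoid_scheme \<Rightarrow> nat \<Rightarrow> (nat \<Rightarrow> 'g \<Rightarrow> complex) \<Rightarrow> ((nat \<Rightarrow>\<^sub>0 nat) \<Rightarrow>\<^sub>0 'k::field) set"
  where
  "monomial_algebra G r \<chi> =
    Modules.module.span poly_scale ((\<lambda>a. Poly_Mapping.single a 1) ` monomial_exponents G r \<chi>)"

lemma monomial_exponents_zero: "0 \<in> monomial_exponents G r \<chi>"
  by (simp add: monomial_exponents_def monomial_monoid.zero)

lemma monomial_exponents_add:
  assumes "a \<in> monomial_exponents G r \<chi>" "b \<in> monomial_exponents G r \<chi>"
  shows "a + b \<in> monomial_exponents G r \<chi>"
  using assms monomial_monoid.add[of _ G] Poly_Mapping.keys_add[of a b]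
  by (fastforce simp: monomial_exponents_def lookup_add distrib_right sum.distrib)

lemma one_in_monomial_algebra: "1 \<in> monomial_algebra G r \<chi>"
proof -
  interpret vector_space "poly_scale :: 'a \<Rightarrow> _" by (rule vector_space_poly_scale)
  show ?thesis
    unfolding monomial_algebra_def using monomial_exponents_zero
    by (intro span_base) (force simp flip: single_one)
qed

lemma monomial_algebra_mult:
  fixes p q :: "(nat \<Rightarrow>\<^sub>0 nat) \<Rightarrow>\<^sub>0 'k::field"
  assumes p: "p \<in> monomial_algebra G r \<chi>" and q: "q \<in> monomial_algebra G r \<chi>"
  shows "p * q \<in> monomial_algebra G r \<chi>"
proof -
  interpret vector_space "poly_scale :: 'k \<Rightarrow> _" by (rule vector_space_poly_scale)
  let ?A = "monomial_algebra G r \<chi> :: ((nat \<Rightarrow>\<^sub>0 nat) \<Rightarrow>\<^sub>0 'k) set"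
  have mono: "Poly_Mapping.single a 1 * q \<in> ?A" if a: "a \<in> monomial_exponents G r \<chi>" for a
    using q unfolding monomial_algebra_def
  proof (induction q rule: span_induct_alt)
    case base
    then show ?case by (simp add: span_zero)
  next
    case (step c x y)
    then obtain b where b: "b \<in> monomial_exponents G r \<chi>" "x = Poly_Mapping.single b 1" by auto
    have "Poly_Mapping.single a 1 * (poly_scale c x + y) =
      poly_scale c (Poly_Mapping.single (a + b) 1) + Poly_Mapping.single a 1 * y"
      by (simp add: b poly_scale_def algebra_simps mult_single)
    then show ?case
      using step.IH monomial_exponents_add[OF a b(1)]
      by (simp add: span_add span_scale span_base)
  qed
  show ?thesis
    using p unfolding monomial_algebra_def[of G r \<chi>]
  proof (induction p rule: span_induct_alt)
    case base
    then show ?case by (simp add: span_zero)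
  next
    case (step c x y)
    have "(poly_scale c x + y) * q = poly_scale c (x * q) + y * q"
      by (simp add: poly_scale_def algebra_simps)
    then show ?case
      using step mono unfolding monomial_algebra_def by (auto intro!: span_add span_scale)
  qed
qed

lemma monomial_algebra_subset: "monomial_algebra G r \<chi> \<subseteq> polys_in {1..r}"
proof -
  interpret vector_space "poly_scale :: 'a \<Rightarrow> _" by (rule vector_space_poly_scale)
  have lk: "Poly_Mapping.lookup (poly_scale c p) a = c * Poly_Mapping.lookup p a"
    for c :: 'a and p a
    unfolding poly_scale_def mult_map_scale_conv_mult[symmetric]
    by (simp add: Poly_Mapping.map.rep_eq when_def)
  show ?thesis
  proof
    fix p :: "(nat \<Rightarrow>\<^sub>0 nat) \<Rightarrow>\<^sub>0 'a"
    assume "p \<in> monomial_algebra G r \<chi>"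
    then show "p \<in> polys_in {1..r}"
      unfolding monomial_algebra_def
    proof (induction p rule: span_induct_alt)
      case base
      then show ?case by (simp add: polys_in_def)
    next
      case (step c x y)
      then obtain b where b: "Poly_Mapping.keys b \<subseteq> {1..r}" "x = Poly_Mapping.single b 1"
        unfolding monomial_exponents_def by blast
      have "Poly_Mapping.keys (poly_scale c x) \<subseteq> {b}"
        by (auto simp: b(2) lk in_keys_iff lookup_single when_def split: if_splits)
      then have "Poly_Mapping.keys (poly_scale c x + y) \<subseteq> insert b (Poly_Mapping.keys y)"
        using Poly_Mapping.keys_add[of "poly_scale c x" y] by blast
      then show ?case
        using step.IH b(1) unfolding polys_in_def by blast
    qed
  qed
qed

end

theory Submission
  imports Defs "HOL-Algebra.Multiplicative_Group"
begin

text \<open>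
  Inflation identifies the characters of \<open>G/N\<close> induced from linear characters with the
  characters of \<open>G\<close> induced from linear characters \<open>\<mu>\<close> of subgroups \<open>H\<close> such that
  \<open>N \<subseteq> H\<close> and \<open>\<mu> = 1\<close> on \<open>N\<close>. Conversely, a sum \<open>\<phi>\<close> of monomial characters satisfies
  \<open>\<bar>\<phi> g\<bar> \<le> \<phi> 1\<close>; so if such a sum is constant on \<open>N\<close>, then every summand is, and the equality
  case of the triangle inequality in the formula for the induced character forces \<open>N \<subseteq> H\<close> and
  \<open>\<mu> = 1\<close> on \<open>N\<close>. Hence an exponent vector supported on \<open>{1..s}\<close> belongs to \<open>M(G/N)\<close> iff it
  belongs to \<open>M(G)\<close>, and both algebras are spanned by monomials.
\<close>

section \<open>Algebras spanned by monomials\<close>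

text \<open>Monomials are linearly independent, so membership in their span can be read off the
  support. This reduces the equality of the two algebras to an equality of sets of exponent
  vectors.\<close>

lemma span_monomials:
  "Modules.module.span poly_scale ((\<lambda>a. Poly_Mapping.single a (1::'k::field)) ` E) =
    {p. Poly_Mapping.keys p \<subseteq> E}"
    (is "_ = ?P")
proof -
  interpret vector_space "poly_scale :: 'k \<Rightarrow> _" by (rule vector_space_poly_scale)
  let ?S = "(\<lambda>a. Poly_Mapping.single a (1::'k)) ` E"
  show ?thesis
  proof (rule subset_antisym)
    show "span ?S \<subseteq> ?P"
    proof (rule span_minimal)
      have "Poly_Mapping.keys (poly_scale c p) \<subseteq> Poly_Mapping.keys p"
        for c :: 'k and p :: "(nat \<Rightarrow>\<^sub>0 nat) \<Rightarrow>\<^sub>0 'k"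
        using keys_mult[of "Poly_Mapping.single 0 c" p]
        by (auto simp: poly_scale_def split: if_splits)
      then show "subspace ?P"
        using Poly_Mapping.keys_add by (intro subspaceI) fastforce+
    qed auto
    show "?P \<subseteq> span ?S"
    proof
      fix p :: "(nat \<Rightarrow>\<^sub>0 nat) \<Rightarrow>\<^sub>0 'k"
      assume p: "p \<in> ?P"
      have "p = (\<Sum>a\<in>Poly_Mapping.keys p. Poly_Mapping.single a (Poly_Mapping.lookup p a))"
        by (rule poly_mapping_eqI)
          (auto simp: lookup_sum lookup_single when_def in_keys_iff sum.delta)
      also have "\<dots> = (\<Sum>a\<in>Poly_Mapping.keys p.
          poly_scale (Poly_Mapping.lookup p a) (Poly_Mapping.single a 1))"
        by (simp add: poly_scale_def mult_single)
      also have "\<dots> \<in> span ?S"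
        using p by (intro span_sum span_scale span_base) auto
      finally show "p \<in> span ?S" .
    qed
  qed
qed

section \<open>Linear and induced characters\<close>

text \<open>A representation of degree 1 is its own trace. Linear characters thus become
  multiplicative functions extended by zero, and no matrices are needed afterwards.\<close>

lemma linear_character_iff:
  assumes "group G"
  shows "linear_character G \<mu> \<longleftrightarrow>
    (\<forall>g. g \<notin> carrier G \<longrightarrow> \<mu> g = 0) \<and> \<mu> \<one>\<^bsub>G\<^esub> = 1 \<and>
    (\<forall>g\<in>carrier G. \<forall>h\<in>carrier G. \<mu> (g \<otimes>\<^bsub>G\<^esub> h) = \<mu> g * \<mu> h)"
    (is "_ \<longleftrightarrow> ?rhs")
proof -
  interpret group G by fact
  show ?thesis
  proof
    assume "linear_character G \<mu>"
    then obtain n \<rho> where rho: "\<rho> \<in> hom G (units_of (ring_mat TYPE(complex) n ()))"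
      and mu: "\<mu> = rep_char G \<rho>" and mu1: "\<mu> \<one>\<^bsub>G\<^esub> = 1"
      by (auto simp: linear_character_def is_character_def is_rep_def)
    let ?R = "ring_mat TYPE(complex) n ()"
    interpret R: ring ?R by (rule ring_mat)
    have "\<rho> \<one>\<^bsub>G\<^esub> = \<one>\<^bsub>units_of ?R\<^esub>"
      using rho hom_one[of \<rho> G "units_of ?R"] R.units_group \<open>group G\<close> by blast
    then have "\<rho> \<one>\<^bsub>G\<^esub> = 1\<^sub>m n"
      by (simp add: units_of_def ring_mat_def)
    \<comment> \<open>The trace of the identity matrix is the degree, and \<open>\<mu>\<close> takes
      the value 1 at the identity.\<close>
    then have "n = 1"
      using mu1 by (simp add: mu rep_char_def)
    have car: "\<rho> g \<in> carrier_mat 1 1" if "g \<in> carrier G" for g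
      using rho that \<open>n = 1\<close> by (fastforce simp: hom_def units_of_def Units_def ring_mat_def)
    have mul: "\<rho> (g \<otimes>\<^bsub>G\<^esub> h) = \<rho> g * \<rho> h" if "g \<in> carrier G" "h \<in> carrier G" for g h
      using rho that by (simp add: hom_def units_of_def ring_mat_def)
    have val: "\<mu> g = \<rho> g $$ (0, 0)" if "g \<in> carrier G" for g
      using car[OF that] that by (simp add: mu rep_char_def)
    have "\<mu> (g \<otimes>\<^bsub>G\<^esub> h) = \<mu> g * \<mu> h" if "g \<in> carrier G" "h \<in> carrier G" for g h
      using car[OF that(1)] car[OF that(2)] that
      by (simp add: val mul scalar_prod_def)
    then show ?rhs
      using mu1 by (simp add: mu rep_char_def)
  next
    assume R: ?rhs
    define \<rho> where "\<rho> = (\<lambda>g. mat 1 1 (\<lambda>_. \<mu> g))"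
    have mul: "\<rho> g * \<rho> h = \<rho> (g \<otimes>\<^bsub>G\<^esub> h)" if "g \<in> carrier G" "h \<in> carrier G" for g h
      using that R by (intro eq_matI) (auto simp: \<rho>_def scalar_prod_def)
    have one: "\<rho> \<one>\<^bsub>G\<^esub> = 1\<^sub>m 1"
      using R by (intro eq_matI) (auto simp: \<rho>_def)
    have car: "\<rho> g \<in> carrier_mat 1 1" for g
      by (simp add: \<rho>_def)
    have "\<rho> g \<in> Units (ring_mat TYPE(complex) 1 ())" if "g \<in> carrier G" for g
      unfolding Units_def ring_mat_def
      using that car mul[of g "inv\<^bsub>G\<^esub> g"] mul[of "inv\<^bsub>G\<^esub> g" g] one
      by (auto intro!: bexI[of _ "\<rho> (inv\<^bsub>G\<^esub> g)"])
    then have "is_rep G 1 \<rho>"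
      by (auto simp: is_rep_def hom_def units_of_def mul) (simp add: ring_mat_def mul)
    moreover have "\<mu> = rep_char G \<rho>"
      using R by (auto simp: rep_char_def \<rho>_def fun_eq_iff)
    ultimately show "linear_character G \<mu>"
      using R by (auto simp: linear_character_def is_character_def)
  qed
qed

text \<open>The value at \<open>g\<close> is a root of unity, because \<open>g\<close> raised to the
  group order is the identity.\<close>

lemma linear_character_norm:
  assumes "group G" "finite (carrier G)" "linear_character G \<mu>" "g \<in> carrier G"
  shows "cmod (\<mu> g) = 1"
proof -
  interpret group G by fact
  have mu: "\<mu> \<one>\<^bsub>G\<^esub> = 1" "\<And>g h. g \<in> carrier G \<Longrightarrow> h \<in> carrier G \<Longrightarrow> \<mu> (g \<otimes>\<^bsub>G\<^esub> h) = \<mu> g * \<mu> h"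
    using assms linear_character_iff by blast+
  have pow: "\<mu> (g [^]\<^bsub>G\<^esub> (n::nat)) = \<mu> g ^ n" for n
    using assms(4) by (induction n) (auto simp: mu)
  have "\<mu> g ^ Coset.order G = 1"
    using pow[of "Coset.order G"] pow_order_eq_1[OF assms(4)] mu(1) by simp
  then have "cmod (\<mu> g) ^ Coset.order G = 1"
    by (metis norm_one norm_power)
  moreover have "Coset.order G > 0"
    using assms(2) by (simp add: order_gt_0_iff_finite)
  ultimately show ?thesis
    using power_eq_1_iff[of "cmod (\<mu> g)" "Coset.order G"] by auto
qed

lemma linear_character_subgroup:
  assumes "group G" "subgroup H G" "linear_character (G\<lparr>carrier := H\<rparr>) \<mu>"
  shows "\<mu> \<one>\<^bsub>G\<^esub> = 1" and "h \<notin> H \<Longrightarrow> \<mu> h = 0"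
    and "h \<in> H \<Longrightarrow> k \<in> H \<Longrightarrow> \<mu> (h \<otimes>\<^bsub>G\<^esub> k) = \<mu> h * \<mu> k"
  using assms linear_character_iff[OF subgroup.subgroup_is_group[OF assms(2,1)], of \<mu>] by auto

text \<open>Extension by zero makes the bound hold for every \<open>h\<close>, so sums over the
  whole group can be estimated without splitting off the terms outside \<open>H\<close>.\<close>

lemma linear_character_subgroup_norm_le:
  assumes "group G" "finite (carrier G)" "subgroup H G" "linear_character (G\<lparr>carrier := H\<rparr>) \<mu>"
  shows "cmod (\<mu> h) \<le> 1"
proof (cases "h \<in> H")
  case True
  then show ?thesis
    using linear_character_norm[OF subgroup.subgroup_is_group[OF assms(3,1)] _ assms(4)]
      finite_subset[OF subgroup.subset[OF assms(3)] assms(2)] by simp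
next
  case False
  then show ?thesis
    using linear_character_subgroup(2)[OF assms(1,3,4)] by simp
qed

lemma induced_linear_character:
  assumes "group G" "subgroup H G" "linear_character (G\<lparr>carrier := H\<rparr>) \<mu>" "g \<in> carrier G"
  shows "induced G H \<mu> g =
    (\<Sum>x\<in>carrier G. \<mu> (inv\<^bsub>G\<^esub> x \<otimes>\<^bsub>G\<^esub> g \<otimes>\<^bsub>G\<^esub> x)) / of_nat (card H)"
  unfolding induced_def Let_def
  using assms(4) linear_character_subgroup(2)[OF assms(1-3)]
  by (auto intro!: arg_cong2[where f = "(/)"] sum.cong)

lemma induced_linear_character_one:
  assumes "group G" "subgroup H G" "linear_character (G\<lparr>carrier := H\<rparr>) \<mu>"
  shows "induced G H \<mu> \<one>\<^bsub>G\<^esub> = of_nat (card (carrier G)) / of_nat (card H)"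
proof -
  interpret group G by fact
  show ?thesis
    using linear_character_subgroup(1)[OF assms] by (simp add: induced_linear_character[OF assms])
qed

text \<open>The triangle inequality bounds the sum of card \<open>G\<close> terms of modulus at most
  1; at the identity all these terms equal 1, so the bound is attained there.\<close>

lemma induced_linear_character_norm_le:
  assumes "group G" "finite (carrier G)" "subgroup H G" "linear_character (G\<lparr>carrier := H\<rparr>) \<mu>"
    and "g \<in> carrier G"
  shows "cmod (induced G H \<mu> g) \<le> Re (induced G H \<mu> \<one>\<^bsub>G\<^esub>)"
proof -
  have "cmod (\<Sum>x\<in>carrier G. \<mu> (inv\<^bsub>G\<^esub> x \<otimes>\<^bsub>G\<^esub> g \<otimes>\<^bsub>G\<^esub> x)) \<le> (\<Sum>x\<in>carrier G. 1)"
    by (intro order_trans[OF norm_sum] sum_mono linear_character_subgroup_norm_le[OF assms(1-4)])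
  then have "cmod (induced G H \<mu> g) \<le> real (card (carrier G)) / real (card H)"
    unfolding induced_linear_character[OF assms(1,3,4,5)] norm_divide
    by (simp add: divide_right_mono)
  then show ?thesis
    unfolding induced_linear_character_one[OF assms(1,3,4)]
    by (simp add: Re_divide_of_nat)
qed

lemma norm_le_one_Re_eq_one:
  assumes "cmod z \<le> 1" "Re z = 1"
  shows "z = 1"
proof -
  have "(Re z)\<^sup>2 + (Im z)\<^sup>2 \<le> 1"
    using assms(1) by (metis cmod_power2 norm_ge_zero power_le_one)
  then show ?thesis
    using assms(2) by (simp add: complex_eq_iff)
qed

text \<open>Equality case of the preceding estimate: the real parts of card \<open>G\<close> numbers
  in the closed unit disc add up to card \<open>G\<close>, so each real part is 1 and each number is
  1.\<close>

lemma induced_linear_character_kernel: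
  assumes "group G" "finite (carrier G)" "subgroup H G" "linear_character (G\<lparr>carrier := H\<rparr>) \<mu>"
    and g: "g \<in> carrier G" and eq: "induced G H \<mu> g = induced G H \<mu> \<one>\<^bsub>G\<^esub>"
  shows "g \<in> H" "\<mu> g = 1"
proof -
  interpret group G by fact
  let ?f = "\<lambda>x. \<mu> (inv\<^bsub>G\<^esub> x \<otimes>\<^bsub>G\<^esub> g \<otimes>\<^bsub>G\<^esub> x)"
  note le = linear_character_subgroup_norm_le[OF assms(1-4)]
  have "card H > 0"
    using subgroup.finite_imp_card_positive[OF assms(3,2)] .
  then have "(\<Sum>x\<in>carrier G. ?f x) = of_nat (card (carrier G))"
    using eq unfolding induced_linear_character_one[OF assms(1,3,4)]
      induced_linear_character[OF assms(1,3,4) g] by simp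
  then have "(\<Sum>x\<in>carrier G. Re (?f x)) = real (card (carrier G))"
    by (metis Re_sum complex_Re_of_nat)
  then have "(\<Sum>x\<in>carrier G. 1 - Re (?f x)) = 0"
    by (simp add: sum_subtractf)
  moreover have "1 - Re (?f x) \<ge> 0" for x
    using order_trans[OF complex_Re_le_cmod le] by simp
  ultimately have "\<forall>x\<in>carrier G. 1 - Re (?f x) = 0"
    using assms(2) by (simp add: sum_nonneg_eq_0_iff)
  \<comment> \<open>The summand at the identity is \<open>\<mu> g\<close> itself.\<close>
  from bspec[OF this one_closed] show "\<mu> g = 1"
    using norm_le_one_Re_eq_one[OF le] g by simp
  \<comment> \<open>Outside \<open>H\<close> the value would be 0, not 1.\<close>
  then show "g \<in> H"
    using linear_character_subgroup(2)[OF assms(1,3,4)] by force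
qed

section \<open>Inflation of induced characters\<close>

context normal
begin

lemma finite_FactGroup: "finite (carrier G) \<Longrightarrow> finite (carrier (G Mod H))"
  by (simp add: FactGroup_def RCOSETS_def)

lemma carrier_FactGroup_image: "carrier (G Mod H) = (\<lambda>g. H #> g) ` carrier G"
  by (auto simp: FactGroup_def RCOSETS_def)

lemma rcoset_mem_image_iff:
  assumes "subgroup K G" "H \<subseteq> K" "g \<in> carrier G"
  shows "H #> g \<in> (\<lambda>k. H #> k) ` K \<longleftrightarrow> g \<in> K"
proof
  assume "H #> g \<in> (\<lambda>k. H #> k) ` K"
  then obtain k where k: "k \<in> K" "H #> g = H #> k" by auto
  then have "g \<in> H #> k"
    using rcos_self[OF assms(3) subgroup_axioms] by simp
  then show "g \<in> K"
    using k(1) assms(1,2) by (auto simp: r_coset_def intro: subgroup.m_closed)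
qed auto

text \<open>As \<open>H \<subseteq> K\<close>, the fibres of \<open>k \<mapsto> H #> k\<close> on
  \<open>K\<close> are full cosets, each with card \<open>H\<close> elements.\<close>

lemma sum_rcosets:
  fixes f :: "'a set \<Rightarrow> 'c::semiring_1"
  assumes "finite (carrier G)" "subgroup K G" "H \<subseteq> K"
  shows "(\<Sum>x\<in>K. f (H #> x)) = of_nat (card H) * (\<Sum>X\<in>(\<lambda>k. H #> k) ` K. f X)"
proof -
  have KG: "K \<subseteq> carrier G"
    using assms(2) by (rule subgroup.subset)
  have fibre: "{x\<in>K. H #> x = H #> k} = H #> k" if "k \<in> K" for k
  proof (intro subset_antisym subsetI)
    fix x
    assume "x \<in> {x\<in>K. H #> x = H #> k}"
    then show "x \<in> H #> k"
      using rcos_self[OF _ subgroup_axioms, of x] KG by auto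
  next
    fix x
    assume x: "x \<in> H #> k"
    then have "x \<in> K"
      using that assms(2,3) by (auto simp: r_coset_def intro: subgroup.m_closed)
    then show "x \<in> {x\<in>K. H #> x = H #> k}"
      using repr_independence[OF x _ subgroup_axioms] that KG by auto
  qed
  have "(\<Sum>x\<in>K. f (H #> x)) =
      (\<Sum>X\<in>(\<lambda>k. H #> k) ` K. \<Sum>x\<in>{x\<in>K. H #> x = X}. f (H #> x))"
    using finite_subset[OF KG assms(1)] by (rule sum.image_gen)
  also have "\<dots> = (\<Sum>X\<in>(\<lambda>k. H #> k) ` K. of_nat (card H) * f X)"
  proof (intro sum.cong refl)
    fix X
    assume "X \<in> (\<lambda>k. H #> k) ` K"
    then obtain k where k: "k \<in> K" "X = H #> k" by auto
    have "(\<Sum>x\<in>{x\<in>K. H #> x = X}. f (H #> x)) = (\<Sum>x\<in>{x\<in>K. H #> x = X}. f X)"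
      by (intro sum.cong) auto
    also have "\<dots> = of_nat (card (H #> k)) * f X"
      using fibre[OF k(1)] k(2) by simp
    also have "card (H #> k) = card H"
      using card_rcosets_equal[of "H #> k" H] rcosetsI[OF subset, of k] k(1) KG subset by auto
    finally show "(\<Sum>x\<in>{x\<in>K. H #> x = X}. f (H #> x)) = of_nat (card H) * f X" .
  qed
  finally show ?thesis
    by (simp add: sum_distrib_left)
qed

text \<open>Passing to the quotient divides both the sum over the group and the denominator card
  \<open>K\<close> by card \<open>H\<close>, so the quotient formula has the same value.\<close>

lemma inflation_induced:
  assumes fin: "finite (carrier G)" and K: "subgroup K G" and HK: "H \<subseteq> K"
    and \<mu>: "\<And>k. k \<in> K \<Longrightarrow> \<mu> k = \<mu>' (H #> k)"
  shows "inflation G H (induced (G Mod H) ((\<lambda>k. H #> k) ` K) \<mu>') = induced G K \<mu>"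
proof
  fix g
  let ?K = "(\<lambda>k. H #> k) ` K"
  show "inflation G H (induced (G Mod H) ?K \<mu>') g = induced G K \<mu> g"
  proof (cases "g \<in> carrier G")
    case True
    \<comment> \<open>\<open>F\<close> is the summand of the induced character in the quotient; the
      summand in \<open>G\<close> at \<open>x\<close> depends only on the coset of \<open>x\<close>
      and equals \<open>F (H #> x)\<close>.\<close>
    define F where "F X = (let Y = inv\<^bsub>G Mod H\<^esub> X \<otimes>\<^bsub>G Mod H\<^esub> (H #> g) \<otimes>\<^bsub>G Mod H\<^esub> X
      in if Y \<in> ?K then \<mu>' Y else 0)" for X
    have F: "(let y = inv x \<otimes> g \<otimes> x in if y \<in> K then \<mu> y else 0) = F (H #> x)"
      if x: "x \<in> carrier G" for x
    proof -
      have "inv\<^bsub>G Mod H\<^esub> (H #> x) \<otimes>\<^bsub>G Mod H\<^esub> (H #> g) \<otimes>\<^bsub>G Mod H\<^esub> (H #> x) =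
          H #> (inv x \<otimes> g \<otimes> x)"
        using x True carrier_FactGroup_image
        by (simp add: inv_FactGroup rcos_inv rcos_sum)
      then show ?thesis
        using x True rcoset_mem_image_iff[OF K HK] \<mu> by (simp add: F_def Let_def)
    qed
    have cH: "card H > 0"
      using subgroup.finite_imp_card_positive[OF subgroup_axioms fin] .
    have "card K = card H * card ?K"
      \<comment> \<open>Summing the constant 1 counts elements on one side and cosets on the
        other.\<close>
      using sum_rcosets[OF fin K HK, of "\<lambda>_. 1 :: nat"] by simp
    moreover have "(\<Sum>x\<in>carrier G. let y = inv x \<otimes> g \<otimes> x in if y \<in> K then \<mu> y else 0) =
        of_nat (card H) * (\<Sum>X\<in>carrier (G Mod H). F X)"
      using sum_rcosets[OF fin subgroup_self subset, of F]
      by (simp add: F carrier_FactGroup_image)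
    ultimately show ?thesis
      using True cH carrier_FactGroup_image
      by (simp add: inflation_def induced_def F_def)
  qed (simp add: inflation_def induced_def)
qed

text \<open>Multiplicativity passes in both directions along the surjection from \<open>K\<close>
  onto its image, since \<open>\<mu>\<close> is the pullback of \<open>\<mu>'\<close>.\<close>

lemma linear_character_inflation_iff:
  assumes K: "subgroup K G" and HK: "H \<subseteq> K"
    and \<mu>: "\<And>k. k \<in> K \<Longrightarrow> \<mu> k = \<mu>' (H #> k)" "\<And>g. g \<notin> K \<Longrightarrow> \<mu> g = 0"
    and \<mu>': "\<And>X. X \<notin> (\<lambda>k. H #> k) ` K \<Longrightarrow> \<mu>' X = 0"
    and K': "subgroup ((\<lambda>k. H #> k) ` K) (G Mod H)"
  shows "linear_character ((G Mod H)\<lparr>carrier := (\<lambda>k. H #> k) ` K\<rparr>) \<mu>' \<longleftrightarrow>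
    linear_character (G\<lparr>carrier := K\<rparr>) \<mu>"
proof -
  have KG: "k \<in> carrier G" if "k \<in> K" for k
    using K that by (rule subgroup.mem_carrier)
  have "\<mu>' H = \<mu> \<one>"
    using \<mu>(1)[OF subgroup.one_closed[OF K]] coset_mult_one[OF subset] by simp
  then show ?thesis
    unfolding linear_character_iff[OF subgroup.subgroup_is_group[OF K is_group]]
      linear_character_iff[OF subgroup.subgroup_is_group[OF K' factorgroup_is_group]]
    using \<mu> \<mu>' by (auto simp: rcos_sum KG subgroup.m_closed[OF K])
qed

lemma group_hom_rcosets: "group_hom G (G Mod H) (\<lambda>a. H #> a)"
  using r_coset_hom_Mod factorgroup_is_group is_group
  by (simp add: group_hom_def group_hom_axioms_def)

lemma rcosets_subgroup:
  assumes "subgroup K G"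
  shows "subgroup ((\<lambda>k. H #> k) ` K) (G Mod H)"
  using group_hom_rcosets assms by (rule group_hom.subgroup_img_is_subgroup)

lemma inflation_monomial_character:
  assumes fin: "finite (carrier G)" and "monomial_character (G Mod H) \<phi>"
  shows "monomial_character G (inflation G H \<phi>)"
proof -
  from assms obtain K' \<mu>' where K': "subgroup K' (G Mod H)"
    and \<mu>': "linear_character ((G Mod H)\<lparr>carrier := K'\<rparr>) \<mu>'" and \<phi>: "\<phi> = induced (G Mod H) K' \<mu>'"
    by (auto simp: monomial_character_def)
  \<comment> \<open>The full preimage of \<open>K'\<close> contains \<open>H\<close> and maps onto
    \<open>K'\<close>; the linear character is pulled back to it.\<close>
  define K where "K = {g \<in> carrier G. H #> g \<in> K'}"
  define \<mu> where "\<mu> g = (if g \<in> K then \<mu>' (H #> g) else 0)" for g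
  interpret h: group_hom G "G Mod H" "\<lambda>a. H #> a"
    by (rule group_hom_rcosets)
  have K: "subgroup K G"
    using subgroup.m_closed[OF K'] subgroup.m_inv_closed[OF K'] subgroup.one_closed[OF K']
      h.hom_mult h.hom_inv h.hom_one
    by (intro subgroup.intro) (auto simp: K_def simp del: mult_FactGroup one_FactGroup)
  have HK: "H \<subseteq> K"
    using subset subgroup.one_closed[OF K'] by (auto simp: K_def rcos_const)
  have im: "(\<lambda>k. H #> k) ` K = K'"
    using subgroup.subset[OF K'] by (auto simp: K_def carrier_FactGroup_image)
  have "linear_character (G\<lparr>carrier := K\<rparr>) \<mu>"
    using linear_character_inflation_iff[OF K HK, of \<mu> \<mu>'] K' \<mu>'
      linear_character_subgroup(2)[OF factorgroup_is_group K' \<mu>'] by (simp add: \<mu>_def im)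
  moreover have "inflation G H \<phi> = induced G K \<mu>"
    using inflation_induced[OF fin K HK, of \<mu> \<mu>'] by (simp add: \<phi> im \<mu>_def)
  ultimately show ?thesis
    using K by (auto simp: monomial_character_def)
qed

lemma inflation_add: "inflation G H (\<lambda>X. \<phi> X + \<psi> X) = (\<lambda>g. inflation G H \<phi> g + inflation G H \<psi> g)"
  by (auto simp: inflation_def)

lemma inflation_monomial_monoid:
  assumes "finite (carrier G)" and "\<phi> \<in> monomial_monoid (G Mod H)"
  shows "inflation G H \<phi> \<in> monomial_monoid G"
  using assms(2)
proof induction
  case zero
  then show ?case
    using monomial_monoid.zero by (simp add: inflation_def)
next
  case (monomial \<phi>)
  then show ?case
    using assms(1) inflation_monomial_character monomial_monoid.monomial by blast
next
  case (add \<phi> \<psi>)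
  then show ?case
    by (simp add: inflation_add monomial_monoid.add)
qed

text \<open>The equality case gives \<open>H \<subseteq> K\<close> and \<open>\<mu> = 1\<close> on
  \<open>H\<close>, so \<open>\<mu>\<close> is constant on the cosets of \<open>H\<close> in
  \<open>K\<close> and descends to the quotient.\<close>

lemma monomial_character_deflation:
  assumes fin: "finite (carrier G)" and "monomial_character G \<phi>"
    and ker: "\<And>n. n \<in> H \<Longrightarrow> \<phi> n = \<phi> \<one>"
  shows "\<exists>\<phi>'. monomial_character (G Mod H) \<phi>' \<and> \<phi> = inflation G H \<phi>'"
proof -
  from assms obtain K \<mu> where K: "subgroup K G"
    and lin: "linear_character (G\<lparr>carrier := K\<rparr>) \<mu>" and \<phi>: "\<phi> = induced G K \<mu>"
    by (auto simp: monomial_character_def)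
  note \<mu> = linear_character_subgroup[OF is_group K lin]
  have \<mu>H: "n \<in> K" "\<mu> n = 1" if "n \<in> H" for n
    using induced_linear_character_kernel[OF is_group fin K lin, of n] ker[OF that] subset that
    by (auto simp: \<phi>)
  then have HK: "H \<subseteq> K"
    by blast
  let ?K = "(\<lambda>k. H #> k) ` K"
  \<comment> \<open>The choice of representative is harmless:
    \<open>\<mu> (n \<otimes> k) = \<mu> n * \<mu> k = \<mu> k\<close> for \<open>n \<in> H\<close>
    and \<open>k \<in> K\<close>.\<close>
  define \<mu>' where "\<mu>' X = (if X \<in> ?K then \<mu> (SOME x. x \<in> X) else 0)" for X
  have \<mu>': "\<mu> k = \<mu>' (H #> k)" if k: "k \<in> K" for k
  proof -
    have "k \<in> H #> k"
      using rcos_self[OF subgroup.mem_carrier[OF K k] subgroup_axioms] .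
    then have "(SOME x. x \<in> H #> k) \<in> H #> k"
      by (rule someI)
    then obtain n where n: "n \<in> H" "(SOME x. x \<in> H #> k) = n \<otimes> k"
      by (auto simp: r_coset_def)
    then show ?thesis
      using k HK \<mu>(3)[of n k] by (auto simp: \<mu>'_def \<mu>H)
  qed
  have "linear_character ((G Mod H)\<lparr>carrier := ?K\<rparr>) \<mu>'"
    using linear_character_inflation_iff[OF K HK, of \<mu> \<mu>'] \<mu>' \<mu>(2) rcosets_subgroup[OF K] lin
    by (simp add: \<mu>'_def)
  then have "monomial_character (G Mod H) (induced (G Mod H) ?K \<mu>')"
    using rcosets_subgroup[OF K] by (auto simp: monomial_character_def)
  then show ?thesis
    using inflation_induced[OF fin K HK, of \<mu> \<mu>'] \<mu>' \<phi> by metis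
qed

end

section \<open>Deflation of sums of monomial characters\<close>

lemma monomial_monoid_norm_le:
  assumes "group G" "finite (carrier G)" "\<phi> \<in> monomial_monoid G" and g: "g \<in> carrier G"
  shows "cmod (\<phi> g) \<le> Re (\<phi> \<one>\<^bsub>G\<^esub>)"
  using assms(3)
proof induction
  case (monomial \<phi>)
  then show ?case
    using induced_linear_character_norm_le[OF assms(1,2) _ _ g] by (auto simp: monomial_character_def)
next
  case (add \<phi> \<psi>)
  then show ?case
    using norm_triangle_ineq[of "\<phi> g" "\<psi> g"] by simp
qed simp

text \<open>Intended for \<open>a\<close>, \<open>b\<close> the values of two summands at an element
  of the normal subgroup and \<open>c\<close>, \<open>d\<close> their values at the identity. Real
  parts can only add up to equality if \<open>Re a = Re c\<close>.\<close>

lemma eq_of_add_eq_of_norm_le: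
  assumes "a + b = c + d" "cmod a \<le> Re c" "cmod b \<le> Re d" "cmod c \<le> Re c"
  shows "a = c"
proof -
  have "Re a + Re b = Re c + Re d"
    using assms(1) by (metis plus_complex.sel(1))
  then have "Re a = Re c"
    using assms(2,3) complex_Re_le_cmod[of a] complex_Re_le_cmod[of b] by linarith
  \<comment> \<open>With equal real parts, both \<open>a\<close> and \<open>c\<close> satisfy this
    condition, so both are real.\<close>
  moreover have "Im z = 0" if "cmod z \<le> Re z" for z
    using order_antisym[OF that complex_Re_le_cmod] cmod_power2[of z] by simp
  ultimately show ?thesis
    using assms(2,4) by (simp add: complex_eq_iff)
qed

text \<open>Induction over the monoid. In the additive case, constancy on \<open>H\<close> must
  first be passed from the sum to each summand before the induction hypotheses apply.\<close>

lemma (in normal) monomial_monoid_deflation: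
  assumes fin: "finite (carrier G)" and "\<phi> \<in> monomial_monoid G"
    and "\<And>n. n \<in> H \<Longrightarrow> \<phi> n = \<phi> \<one>"
  shows "\<exists>\<phi>'\<in>monomial_monoid (G Mod H). \<phi> = inflation G H \<phi>'"
  using assms(2,3)
proof induction
  case zero
  then show ?case
    using monomial_monoid.zero[of "G Mod H"] by (force simp: inflation_def)
next
  case (monomial \<phi>)
  then show ?case
    using monomial_character_deflation[OF fin] monomial_monoid.monomial by blast
next
  case (add \<phi> \<psi>)
  note le = monomial_monoid_norm_le[OF is_group fin]
  have eq: "\<phi> n = \<phi> \<one>" "\<psi> n = \<psi> \<one>" if "n \<in> H" for n
  proof -
    have n: "n \<in> carrier G"
      using that subset by auto
    show "\<phi> n = \<phi> \<one>"
      using eq_of_add_eq_of_norm_le[OF add.prems[OF that]] le[OF add.hyps(1)] le[OF add.hyps(2)] n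
      by simp
    then show "\<psi> n = \<psi> \<one>"
      using add.prems[OF that] by simp
  qed
  then obtain \<phi>' \<psi>' where "\<phi>' \<in> monomial_monoid (G Mod H)" "\<phi> = inflation G H \<phi>'"
    "\<psi>' \<in> monomial_monoid (G Mod H)" "\<psi> = inflation G H \<psi>'"
    using add.IH by blast
  then show ?case
    by (intro bexI[of _ "\<lambda>X. \<phi>' X + \<psi>' X"]) (auto simp: inflation_add monomial_monoid.add)
qed

lemma monomial_monoid_outside:
  assumes "\<phi> \<in> monomial_monoid G" "g \<notin> carrier G"
  shows "\<phi> g = 0"
  using assms by induction (auto simp: monomial_character_def induced_def)

text \<open>Inflation ignores values outside the carrier of the quotient. The vanishing assumption
  on \<open>\<phi>\<close> makes it injective, so the deflated function must be
  \<open>\<phi>\<close> itself.\<close>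

lemma (in normal) inflation_in_monomial_monoid_iff:
  assumes fin: "finite (carrier G)" and \<phi>: "\<And>X. X \<notin> carrier (G Mod H) \<Longrightarrow> \<phi> X = 0"
  shows "inflation G H \<phi> \<in> monomial_monoid G \<longleftrightarrow> \<phi> \<in> monomial_monoid (G Mod H)"
proof
  assume inf: "inflation G H \<phi> \<in> monomial_monoid G"
  have "inflation G H \<phi> n = inflation G H \<phi> \<one>" if "n \<in> H" for n
    using that subset by (auto simp: inflation_def rcos_const)
  then obtain \<phi>' where \<phi>': "\<phi>' \<in> monomial_monoid (G Mod H)" "inflation G H \<phi> = inflation G H \<phi>'"
    using monomial_monoid_deflation[OF fin inf] by blast
  have "\<phi> X = \<phi>' X" for X
  proof (cases "X \<in> carrier (G Mod H)")
    case True
    then obtain g where "g \<in> carrier G" "X = H #> g"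
      by (auto simp: carrier_FactGroup_image)
    then show ?thesis
      using fun_cong[OF \<phi>'(2), of g] by (simp add: inflation_def)
  next
    case False
    then show ?thesis
      using \<phi> monomial_monoid_outside[OF \<phi>'(1)] by simp
  qed
  then show "\<phi> \<in> monomial_monoid (G Mod H)"
    using \<phi>'(1) by presburger
qed (rule inflation_monomial_monoid[OF fin])

theorem theorem2p11:
  fixes G :: "('g, 'm) monoid_scheme" and N :: "'g set"
    and r s :: nat
    and \<chi> :: "nat \<Rightarrow> 'g \<Rightarrow> complex" and \<chi>' :: "nat \<Rightarrow> 'g set \<Rightarrow> complex"
  assumes "group G" and "finite (carrier G)" and "N \<lhd> G"
    and "bij_betw \<chi> {1..r} (Irr G)"
    and "bij_betw \<chi>' {1..s} (Irr (G Mod N))"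
    and "s \<le> r"
    and "\<forall>i\<in>{1..s}. \<chi> i = inflation G N (\<chi>' i)"
  shows "(monomial_algebra (G Mod N) s \<chi>' :: ((nat \<Rightarrow>\<^sub>0 nat) \<Rightarrow>\<^sub>0 'k::field) set) =
    monomial_algebra G r \<chi> \<inter> polys_in {1..s}"
proof -
  have out: "\<chi>' i X = 0" if "i \<in> {1..s}" "X \<notin> carrier (G Mod N)" for i X
    using bij_betwE[OF assms(5)] that by (fastforce simp: Irr_def rep_char_def)
  have "a \<in> monomial_exponents (G Mod N) s \<chi>' \<longleftrightarrow> a \<in> monomial_exponents G r \<chi>"
    if a: "Poly_Mapping.keys a \<subseteq> {1..s}" for a
  proof -
    let ?\<phi> = "\<lambda>X. \<Sum>i=1..s. of_nat (Poly_Mapping.lookup a i) * \<chi>' i X"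
    \<comment> \<open>The exponents at indices above \<open>s\<close> are zero, so only characters
      inflated from the quotient contribute.\<close>
    have "(\<Sum>i=1..r. of_nat (Poly_Mapping.lookup a i) * \<chi> i g) =
        (\<Sum>i=1..s. of_nat (Poly_Mapping.lookup a i) * \<chi> i g)" for g
      using a assms(6) by (intro sum.mono_neutral_right) (auto simp: in_keys_iff)
    then have "(\<lambda>g. \<Sum>i=1..r. of_nat (Poly_Mapping.lookup a i) * \<chi> i g) = inflation G N ?\<phi>"
      using assms(7) by (auto simp: inflation_def fun_eq_iff)
    moreover have "inflation G N ?\<phi> \<in> monomial_monoid G \<longleftrightarrow> ?\<phi> \<in> monomial_monoid (G Mod N)"
      using out by (intro normal.inflation_in_monomial_monoid_iff[OF assms(3,2)]) simp
    moreover have "Poly_Mapping.keys a \<subseteq> {1..r}"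
      using a assms(6) by auto
    ultimately show ?thesis
      using a by (simp add: monomial_exponents_def)
  qed
  \<comment> \<open>Hence the exponent set of the quotient consists exactly of the exponents for
    \<open>G\<close> supported in \<open>{1..s}\<close>, and the description of spans by supports
    finishes the proof.\<close>
  moreover have "Poly_Mapping.keys a \<subseteq> {1..s}" if "a \<in> monomial_exponents (G Mod N) s \<chi>'" for a
    using that by (simp add: monomial_exponents_def)
  ultimately show ?thesis
    unfolding monomial_algebra_def span_monomials polys_in_def by blast
qed

end
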